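(* Let $0<\alpha<1$, let $W(x)=\begin{pmatrix}|x|^\alpha&0\\0&|x|^{-\alpha}\end{pmatrix}$ for $x\in\mathbb{R}$ (a matrix $A_2$ weight on $\mathbb{R}$), and let $\mathscr{D}$ be the standard dyadic grid on $\mathbb{R}$. Then there exists a sequence $\{A_I\}_{I\in\mathscr{D}}$ of $2\times2$ matrices such that the Haar multiplier $$T_A\vec f=\sum_{I\in\mathscr{D}}A_I\vec f_I\,h_I$$ is not bounded on $L^2(W)$.
   Context: The standard dyadic grid on $\mathbb{R}$ is $\{[2^{-k}m,2^{-k}(m+1)):k,m\in\mathbb{Z}\}$. For an interval $I$ with left and right halves $I_\ell,I_r$, $h_I=|I|^{-1/2}(\chi_{I_\ell}-\chi_{I_r})$, and $\vec f_I=\int\vec f\,h_I\,dx$ (componentwise). $L^2(W)$ is the space of measurable $\vec f:\mathbb{R}\to\mathbb{C}^2$ with $\|\vec f\|_{L^2(W)}^2=\int_{\mathbb{R}}|W^{1/2}(x)\vec f(x)|^2\,dx<\infty$. *)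

theory Defs
  imports "HOL-Analysis.Analysis"
begin

definition dyadic_interval :: "int \<Rightarrow> int \<Rightarrow> real set" where
  "dyadic_interval k m = {2 powi (- k) * of_int m ..< 2 powi (- k) * (of_int m + 1)}"

definition dyadic_grid :: "real set set" where
  "dyadic_grid = {dyadic_interval k m | k m. True}"

definition left_half :: "real set \<Rightarrow> real set" where
  "left_half I = {x \<in> I. x < (Inf I + Sup I) / 2}"

definition right_half :: "real set \<Rightarrow> real set" where
  "right_half I = {x \<in> I. (Inf I + Sup I) / 2 \<le> x}"

definition haar :: "real set \<Rightarrow> real \<Rightarrow> real" where
  "haar I x = (indicator (left_half I) x - indicator (right_half I) x) / sqrt (measure lborel I)"

text \<open>For the weight considered here (and any matrix \<open>A\<^sub>2\<close> weight) the functions in the weighted space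
  are locally integrable, so the Bochner integrals below are genuine.\<close>

definition haar_coeff :: "(real \<Rightarrow> complex ^ 2) \<Rightarrow> real set \<Rightarrow> complex ^ 2" where
  "haar_coeff f I = (\<chi> i. LINT x|lebesgue. f x $ i * of_real (haar I x))"

definition pos_semidef :: "complex ^ 2 ^ 2 \<Rightarrow> bool" where
  "pos_semidef B \<longleftrightarrow> (\<forall>i j. B $ i $ j = cnj (B $ j $ i))
     \<and> (\<forall>v. 0 \<le> Re (\<Sum>i\<in>UNIV. cnj (v $ i) * (B *v v) $ i))"

text \<open>The positive semidefinite square root; it is only meaningful for positive semidefinite
  arguments, where it exists and is unique.\<close>

definition mat_sqrt :: "complex ^ 2 ^ 2 \<Rightarrow> complex ^ 2 ^ 2" where
  "mat_sqrt M = (THE B. pos_semidef B \<and> B ** B = M)"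

text \<open>The squared norm takes values in \<^typ>\<open>ennreal\<close>, so it is infinite, and not a junk value,
  outside of the weighted space. The norm on \<^typ>\<open>complex ^ 2\<close> is the Euclidean one.\<close>

definition L2W_norm_sq :: "(real \<Rightarrow> complex ^ 2 ^ 2) \<Rightarrow> (real \<Rightarrow> complex ^ 2) \<Rightarrow> ennreal" where
  "L2W_norm_sq W f = (\<integral>\<^sup>+ x. ennreal ((norm (mat_sqrt (W x) *v f x))\<^sup>2) \<partial>lebesgue)"

definition L2W :: "(real \<Rightarrow> complex ^ 2 ^ 2) \<Rightarrow> (real \<Rightarrow> complex ^ 2) set" where
  "L2W W = {f \<in> borel_measurable lebesgue. L2W_norm_sq W f < \<infinity>}"

definition haar_partial_sum ::
  "(real set \<Rightarrow> complex ^ 2 ^ 2) \<Rightarrow> (real \<Rightarrow> complex ^ 2) \<Rightarrow> real set set \<Rightarrow> real \<Rightarrow> complex ^ 2" where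
  "haar_partial_sum A f F x = (\<Sum>I\<in>F. haar I x *\<^sub>R (A I *v haar_coeff f I))"

text \<open>\<open>haar_multiplier W A f g\<close> says that the series defining the Haar multiplier with symbol
  \<open>A\<close> at \<open>f\<close> converges unconditionally to \<open>g\<close> in the weighted space. The limit \<open>g\<close> is determined
  up to \<open>W\<close>-null differences.\<close>

definition haar_multiplier ::
  "(real \<Rightarrow> complex ^ 2 ^ 2) \<Rightarrow> (real set \<Rightarrow> complex ^ 2 ^ 2) \<Rightarrow>
   (real \<Rightarrow> complex ^ 2) \<Rightarrow> (real \<Rightarrow> complex ^ 2) \<Rightarrow> bool" where
  "haar_multiplier W A f g \<longleftrightarrow> f \<in> L2W W \<and> g \<in> L2W W \<and>
     ((\<lambda>F. L2W_norm_sq W (\<lambda>x. haar_partial_sum A f F x - g x)) \<longlongrightarrow> 0)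
       (finite_subsets_at_top dyadic_grid)"

text \<open>Boundedness is tested on those \<open>f\<close> for which the series converges; for a locally
  integrable weight these include all finite linear combinations of Haar functions. Thus failure of boundedness
  always means that no constant works, never merely that the series diverges for some \<open>f\<close>. The
  inequality is the square of \<open>norm g \<le> C * norm f\<close>.\<close>

definition haar_multiplier_bounded ::
  "(real \<Rightarrow> complex ^ 2 ^ 2) \<Rightarrow> (real set \<Rightarrow> complex ^ 2 ^ 2) \<Rightarrow> bool" where
  "haar_multiplier_bounded W A \<longleftrightarrow>
     (\<exists>C::real. \<forall>f g. haar_multiplier W A f g \<longrightarrow>
        L2W_norm_sq W g \<le> ennreal (C\<^sup>2) * L2W_norm_sq W f)"

text \<open>Since \<open>0 powr a = 0\<close>, the weight is the zero matrix at the origin, a Lebesgue null set.\<close>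

definition power_weight :: "real \<Rightarrow> real \<Rightarrow> complex ^ 2 ^ 2" where
  "power_weight \<alpha> x =
     vector [vector [of_real (\<bar>x\<bar> powr \<alpha>), 0],
             vector [0, of_real (\<bar>x\<bar> powr (- \<alpha>))]]"

end

theory Submission
  imports Defs
begin

text \<open>
  A Haar multiplier with a constant symbol \<open>M\<close> is the pointwise map \<open>f \<mapsto> M f\<close>, since each Haar
  coefficient is multiplied by the same matrix. For \<open>M\<close> the coordinate swap this map sends
  the second coordinate, which is measured with weight \<open>|x| powr - \<alpha>\<close>, to the first, which is measured
  with weight \<open>|x| powr \<alpha>\<close>, much larger than \<open>|x| powr - \<alpha>\<close> far from the origin. So a
  bounded symbol, even one independent of \<open>I\<close>, suffices: what fails is uniform boundedness of the symbol
  after conjugation by the averages of \<open>W\<close> over the intervals \<open>I\<close>.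

  To witness this, take \<open>J = [0, 2 ^ k)\<close> and the input \<open>h\<^sub>J e\<^sub>2\<close>, whose image is \<open>h\<^sub>J e\<^sub>1\<close>. As
  \<open>h\<^sub>J\<^sup>2\<close> is the normalised indicator of \<open>J\<close>, the squared norms of input and image are the averages of
  the two weights over \<open>J\<close>, namely \<open>(2 ^ k) powr - \<alpha> / (1 - \<alpha>)\<close> and \<open>(2 ^ k) powr \<alpha> / (1 + \<alpha>)\<close>
  (\<open>L2W_norm_sq_haar_axis\<close>). Their ratio grows like \<open>(2 powr (2 * \<alpha>)) ^ k\<close>, so no constant bounds the
  operator (\<open>swap_multiplier_unbounded\<close>).

  Two points need an argument. The image is the actual sum of the Haar series because
  Haar functions are orthonormal, which leaves only the term at \<open>J\<close> (\<open>haar_orthonormal\<close>,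
  \<open>haar_multiplier_haar\<close>). The norm involves the square root of the weight, which is determined by
  uniqueness of positive semidefinite square roots of diagonal matrices (\<open>mat_sqrt_diagonal\<close>).
\<close>

section \<open>Square roots of diagonal matrices\<close>

text \<open>The off-diagonal entry \<open>q\<close> of a positive semidefinite square root \<open>B\<close> must vanish: the off-diagonal
  entry of \<open>B\<^sup>2\<close> is \<open>q\<close> times the trace of \<open>B\<close>, and a positive semidefinite matrix of trace zero
  is zero. What is left is uniqueness of nonnegative real square roots.\<close>

lemma mat_sqrt_diagonal:
  fixes a b :: real
  assumes a: "0 \<le> a" and b: "0 \<le> b"
  shows "mat_sqrt (vector [vector [of_real (a\<^sup>2), 0], vector [0, of_real (b\<^sup>2)]])
    = vector [vector [of_real a, 0], vector [0, of_real b]]" (is "mat_sqrt ?M = ?D")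
  unfolding mat_sqrt_def
proof (rule the_equality)
  have "0 \<le> Re (\<Sum>i\<in>UNIV. cnj (v $ i) * (?D *v v) $ i)" for v
  proof -
    have "Re (\<Sum>i\<in>UNIV. cnj (v $ i) * (?D *v v) $ i)
      = a * (cmod (v $ 1))\<^sup>2 + b * (cmod (v $ 2))\<^sup>2"
      unfolding cmod_power2
      by (simp add: matrix_vector_mult_def sum_2 power2_eq_square algebra_simps)
    then show ?thesis using a b by simp
  qed
  then have "pos_semidef ?D"
    unfolding pos_semidef_def by (simp add: forall_2)
  moreover have "?D ** ?D = ?M"
    by (simp add: vec_eq_iff forall_2 matrix_matrix_mult_def sum_2 power2_eq_square)
  ultimately show "pos_semidef ?D \<and> ?D ** ?D = ?M" ..
next
  fix B :: "complex ^ 2 ^ 2"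
  assume "pos_semidef B \<and> B ** B = ?M"
  then have herm: "\<And>i j. B $ i $ j = cnj (B $ j $ i)"
    and pos: "\<And>v. 0 \<le> Re (\<Sum>i\<in>UNIV. cnj (v $ i) * (B *v v) $ i)"
    and sq: "B ** B = ?M" unfolding pos_semidef_def by blast+
  define p q r where "p = Re (B $ 1 $ 1)" and "q = B $ 1 $ 2" and "r = Re (B $ 2 $ 2)"
  have B11: "B $ 1 $ 1 = of_real p" using arg_cong[OF herm[of 1 1], of Im]
    by (simp add: complex_eq_iff p_def)
  have B22: "B $ 2 $ 2 = of_real r" using arg_cong[OF herm[of 2 2], of Im]
    by (simp add: complex_eq_iff r_def)
  have B12: "B $ 1 $ 2 = q" by (simp add: q_def)
  have B21: "B $ 2 $ 1 = cnj q" unfolding q_def by (rule herm)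
  have p: "0 \<le> p" using pos[of "axis 1 1"]
    by (simp add: matrix_vector_mult_def sum_2 axis_def B11)
  have r: "0 \<le> r" using pos[of "axis 2 1"]
    by (simp add: matrix_vector_mult_def sum_2 axis_def B22)
  have e1: "of_real p * of_real p + q * cnj q = complex_of_real (a\<^sup>2)"
    using arg_cong[OF sq, of "\<lambda>M. M $ 1 $ 1"]
    by (simp add: matrix_matrix_mult_def sum_2 B11 B22 B12 B21)
  have e2: "cnj q * q + of_real r * of_real r = complex_of_real (b\<^sup>2)"
    using arg_cong[OF sq, of "\<lambda>M. M $ 2 $ 2"]
    by (simp add: matrix_matrix_mult_def sum_2 B11 B22 B12 B21)
  have e3: "of_real p * q + q * of_real r = 0"
    using arg_cong[OF sq, of "\<lambda>M. M $ 1 $ 2"]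
    by (simp add: matrix_matrix_mult_def sum_2 B11 B22 B12 B21)
  have "q = 0"
  proof (rule ccontr)
    assume q: "q \<noteq> 0"
    have "q * complex_of_real (p + r) = 0" using e3 by (simp add: algebra_simps)
    then have "p + r = 0" using q by (metis mult_eq_0_iff of_real_eq_0_iff)
    then have pr: "p = 0" "r = 0" using p r by linarith+
    \<comment> \<open>The quadratic form of a Hermitian matrix with zero diagonal and \<open>q \<noteq> 0\<close> takes both signs;
      \<open>(- q, 1)\<close> makes it negative.\<close>
    have "0 \<le> - 2 * (cmod q)\<^sup>2"
      using pos[of "vector [- q, 1]"]
      unfolding cmod_power2
      by (simp add: matrix_vector_mult_def sum_2 B11 B22 B12 B21 pr power2_eq_square)
    then show False using q by simp
  qed
  have "p\<^sup>2 = a\<^sup>2" "r\<^sup>2 = b\<^sup>2"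
    using e1 e2 unfolding \<open>q = 0\<close> by (simp_all add: power2_eq_square flip: of_real_mult)
  then have "p = a" "r = b" using a b p r by (simp_all add: power2_eq_iff_nonneg)
  then show "B = ?D"
    using \<open>q = 0\<close> B11 B22 B12 B21 by (simp add: vec_eq_iff forall_2)
qed

lemma abs_powr_half_squared:
  fixes x c :: real
  shows "(\<bar>x\<bar> powr (c / 2))\<^sup>2 = \<bar>x\<bar> powr c"
  by (simp add: power2_eq_square flip: powr_add)

lemma mat_sqrt_power_weight: "mat_sqrt (power_weight \<alpha> x) = power_weight (\<alpha> / 2) x"
  unfolding power_weight_def
  using mat_sqrt_diagonal[of "\<bar>x\<bar> powr (\<alpha> / 2)" "\<bar>x\<bar> powr (- \<alpha> / 2)",
    unfolded abs_powr_half_squared]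
  by simp

section \<open>Orthonormality of the Haar functions\<close>

text \<open>Membership in a dyadic interval is a condition on one floor, which turns nestedness of
  dyadic intervals into integer division by a power of two.\<close>

lemma mem_dyadic_interval_iff: "x \<in> dyadic_interval k m \<longleftrightarrow> \<lfloor>2 powi k * x\<rfloor> = m"
proof -
  have "0 < (2 :: real) powi k" by simp
  then show ?thesis
    unfolding dyadic_interval_def floor_eq_iff power_int_minus
    by (auto simp: field_simps)
qed

lemma coarser_dyadic_interval_iff:
  assumes "l \<le> k" and "x \<in> dyadic_interval k m"
  shows "x \<in> dyadic_interval l n \<longleftrightarrow> m div 2 ^ nat (k - l) = n"
proof -
  have "(2 :: real) powi k = 2 powi l * 2 ^ nat (k - l)"
    using assms(1) by (simp add: power_int_add power_int_diff flip: power_int_of_nat)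
  then have "2 powi l * x = (2 powi k * x) / of_int (2 ^ nat (k - l))"
    by simp
  then have "\<lfloor>2 powi l * x\<rfloor> = \<lfloor>2 powi k * x\<rfloor> div 2 ^ nat (k - l)"
    by (simp only: floor_divide_real_eq_div zero_le_power zero_le_numeral)
  then show ?thesis using assms(2) by (simp add: mem_dyadic_interval_iff)
qed

lemma dyadic_length_halves: "2 powi (- k) = 2 * (2 powi (- (k + 1)) :: real)"
  by (simp add: power_int_diff power_int_minus field_simps power_int_add)

lemma measure_dyadic_interval: "measure lborel (dyadic_interval k m) = 2 powi (- k)"
  unfolding dyadic_interval_def by (simp add: algebra_simps)

lemma measure_lebesgue_dyadic_interval: "measure lebesgue (dyadic_interval k m) = 2 powi (- k)"
  using measure_dyadic_interval[of k m]
  by (subst measure_completion) (simp_all add: dyadic_interval_def)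

lemma midpoint_dyadic_interval:
  "(Inf (dyadic_interval k m) + Sup (dyadic_interval k m)) / 2
    = 2 powi (- (k + 1)) * (2 * of_int m + 1)"
proof -
  show ?thesis
    unfolding dyadic_interval_def using dyadic_length_halves[of k]
    by (simp add: cInf_atLeastLessThan cSup_atLeastLessThan algebra_simps)
qed

lemma left_half_dyadic_interval:
  "left_half (dyadic_interval k m) = dyadic_interval (k + 1) (2 * m)"
proof -
  note dyadic_length_halves[of k]
  moreover have "0 < (2 powi (- (k + 1)) :: real)" by simp
  ultimately show ?thesis
    unfolding left_half_def midpoint_dyadic_interval
    unfolding dyadic_interval_def by (auto simp: algebra_simps)
qed

lemma right_half_dyadic_interval:
  "right_half (dyadic_interval k m) = dyadic_interval (k + 1) (2 * m + 1)"
proof -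
  note dyadic_length_halves[of k]
  moreover have "0 < (2 powi (- (k + 1)) :: real)" by simp
  ultimately show ?thesis
    unfolding right_half_def midpoint_dyadic_interval
    unfolding dyadic_interval_def by (auto simp: algebra_simps)
qed

lemma haar_dyadic_interval:
  "haar (dyadic_interval k m) x =
    (indicator (dyadic_interval (k + 1) (2 * m)) x
      - indicator (dyadic_interval (k + 1) (2 * m + 1)) x) / sqrt (2 powi (- k))"
  unfolding haar_def left_half_dyadic_interval right_half_dyadic_interval
    measure_dyadic_interval ..

lemma integrable_indicator_dyadic_interval:
  "integrable lebesgue (indicator (dyadic_interval k m) :: real \<Rightarrow> real)"
  by (rule integrable_real_indicator) (simp_all add: dyadic_interval_def emeasure_completion)

lemma haar_integrable: "integrable lebesgue (haar (dyadic_interval k m))"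
  unfolding haar_dyadic_interval[abs_def] by (simp add: integrable_indicator_dyadic_interval)

lemma integral_haar: "(LINT x|lebesgue. haar (dyadic_interval k m) x) = 0"
  unfolding haar_dyadic_interval
  by (simp add: integrable_indicator_dyadic_interval measure_lebesgue_dyadic_interval)

lemma haar_squared:
  "(haar (dyadic_interval k m) x)\<^sup>2 = indicator (dyadic_interval k m) x * 2 powi k"
proof -
  have "I = left_half I \<union> right_half I" for I :: "real set"
    unfolding left_half_def right_half_def by (auto simp: not_less)
  from this[of "dyadic_interval k m"]
  have "x \<in> dyadic_interval k m \<longleftrightarrow>
      x \<in> dyadic_interval (k + 1) (2 * m) \<or> x \<in> dyadic_interval (k + 1) (2 * m + 1)"
    unfolding left_half_dyadic_interval right_half_dyadic_interval by blast
  moreover have "\<not> (x \<in> dyadic_interval (k + 1) (2 * m) \<and>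
      x \<in> dyadic_interval (k + 1) (2 * m + 1))"
    by (auto simp: mem_dyadic_interval_iff)
  ultimately show ?thesis
    unfolding haar_dyadic_interval
    by (auto simp: indicator_def power_divide power_int_minus field_simps)
qed

lemma haar_eq_0_outside:
  assumes "x \<notin> dyadic_interval k m"
  shows "haar (dyadic_interval k m) x = 0"
  using haar_squared[of k m x] assms by simp

text \<open>Points of one dyadic interval share every dyadic interval that is at least as long,
  and the halves of a strictly longer interval are still of this kind.\<close>

lemma haar_constant_on_finer:
  assumes "l < k" and "x \<in> dyadic_interval k m" and "y \<in> dyadic_interval k m"
  shows "haar (dyadic_interval l n) x = haar (dyadic_interval l n) y"
proof -
  have "x \<in> dyadic_interval (l + 1) j \<longleftrightarrow> y \<in> dyadic_interval (l + 1) j" for j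
    using assms coarser_dyadic_interval_iff[of "l + 1" k] by simp
  then show ?thesis
    unfolding haar_dyadic_interval indicator_def by simp
qed

lemma haar_orthogonal_finer:
  assumes "l < k"
  shows "(LINT x|lebesgue. haar (dyadic_interval l n) x * haar (dyadic_interval k m) x) = 0"
proof -
  have "2 powi (- k) * of_int m \<in> dyadic_interval k m"
    by (simp add: dyadic_interval_def)
  then have "haar (dyadic_interval l n) x = haar (dyadic_interval l n) (2 powi (- k) * of_int m)"
    if "x \<in> dyadic_interval k m" for x
    using haar_constant_on_finer[OF assms that] by blast
  then have "haar (dyadic_interval l n) x * haar (dyadic_interval k m) x
      = haar (dyadic_interval l n) (2 powi (- k) * of_int m) * haar (dyadic_interval k m) x" for x
    using haar_eq_0_outside[of x k m] by (metis mult_zero_right)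
  then show ?thesis
    by (simp only: integral_mult_right_zero integral_haar mult_zero_right)
qed

lemma haar_orthonormal:
  assumes "I \<in> dyadic_grid" and "J \<in> dyadic_grid"
  shows "(LINT x|lebesgue. haar J x * haar I x) = (if I = J then 1 else 0)"
proof -
  obtain k m l n where I: "I = dyadic_interval k m" and J: "J = dyadic_interval l n"
    using assms by (auto simp: dyadic_grid_def)
  show ?thesis
  proof (cases "I = J")
    case True
    have "haar J x * haar I x = indicator (dyadic_interval k m) x * 2 powi k" for x
      using haar_squared[of k m x] True I by (simp add: power2_eq_square)
    then show ?thesis
      using True by (simp add: measure_lebesgue_dyadic_interval power_int_minus)
  next
    case False
    consider "l < k" | "k < l" | "k = l" "m \<noteq> n"
      using False I J by fastforce
    then have "(LINT x|lebesgue. haar J x * haar I x) = 0"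
    proof cases
      case 1
      then show ?thesis using haar_orthogonal_finer I J by simp
    next
      case 2
      then show ?thesis using haar_orthogonal_finer[of k l m n] I J by (simp add: mult.commute)
    next
      case 3
      then have "haar J x * haar I x = 0" for x
        using haar_eq_0_outside[of x k m] haar_eq_0_outside[of x l n] I J
        by (auto simp: mem_dyadic_interval_iff)
      then show ?thesis by (simp only: Bochner_Integration.integral_zero)
    qed
    then show ?thesis using False by simp
  qed
qed

lemma haar_coeff_haar:
  assumes "I \<in> dyadic_grid" and "J \<in> dyadic_grid"
  shows "haar_coeff (\<lambda>x. haar J x *\<^sub>R v) I = (if I = J then v else 0)"
proof -
  have "(LINT x|lebesgue. (haar J x *\<^sub>R v) $ i * complex_of_real (haar I x))
      = of_real (LINT x|lebesgue. haar J x * haar I x) * v $ i" for i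
  proof -
    have "(LINT x|lebesgue. (haar J x *\<^sub>R v) $ i * complex_of_real (haar I x))
      = (LINT x|lebesgue. complex_of_real (haar J x * haar I x) * v $ i)"
      unfolding vector_scaleR_component unfolding scaleR_conv_of_real by (simp add: mult_ac)
    then show ?thesis
      by (simp only: integral_mult_left_zero integral_complex_of_real)
  qed
  then show ?thesis
    using assms by (simp add: haar_coeff_def vec_eq_iff haar_orthonormal)
qed

section \<open>Haar multipliers on single Haar functions\<close>

text \<open>By orthonormality, the net of partial sums is constant as soon as the index set contains \<open>J\<close>.\<close>

lemma haar_multiplier_haar:
  assumes J: "J \<in> dyadic_grid"
    and "(\<lambda>x. haar J x *\<^sub>R v) \<in> L2W W" and "(\<lambda>x. haar J x *\<^sub>R (A J *v v)) \<in> L2W W"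
  shows "haar_multiplier W A (\<lambda>x. haar J x *\<^sub>R v) (\<lambda>x. haar J x *\<^sub>R (A J *v v))"
proof -
  let ?f = "\<lambda>x. haar J x *\<^sub>R v" and ?g = "\<lambda>x. haar J x *\<^sub>R (A J *v v)"
  have "L2W_norm_sq W (\<lambda>x. haar_partial_sum A ?f F x - ?g x) = 0"
    if F: "finite F" "F \<subseteq> dyadic_grid" "J \<in> F" for F
  proof -
    have "haar_partial_sum A ?f F x = ?g x" for x
    proof -
      have "haar_partial_sum A ?f F x = (\<Sum>I\<in>F. if I = J then ?g x else 0)"
        unfolding haar_partial_sum_def
      proof (rule sum.cong)
        fix I assume "I \<in> F"
        then have "haar_coeff ?f I = (if I = J then v else 0)"
          using F J by (intro haar_coeff_haar) auto
        then show "haar I x *\<^sub>R (A I *v haar_coeff ?f I) = (if I = J then ?g x else 0)"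
          by simp
      qed simp
      then show ?thesis using F by simp
    qed
    then show ?thesis by (simp add: L2W_norm_sq_def)
  qed
  then have "\<forall>\<^sub>F F in finite_subsets_at_top dyadic_grid.
      L2W_norm_sq W (\<lambda>x. haar_partial_sum A ?f F x - ?g x) = 0"
    using J unfolding eventually_finite_subsets_at_top by (intro exI[of _ "{J}"]) auto
  then show ?thesis
    using assms unfolding haar_multiplier_def by (simp add: tendsto_eventually)
qed

text \<open>The average of \<open>|x| powr c\<close> over \<open>[0, 2 ^ k)\<close>.\<close>

lemma nn_integral_haar_squared_powr:
  fixes c :: real and k :: nat
  assumes "- 1 < c"
  shows "(\<integral>\<^sup>+ x. ennreal ((haar (dyadic_interval (- int k) 0) x)\<^sup>2 * \<bar>x\<bar> powr c) \<partial>lebesgue)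
    = ennreal ((2 ^ k) powr c / (c + 1))"
proof -
  let ?R = "2 ^ k :: real"
  have "((\<lambda>x. x powr c) has_integral (?R powr (c + 1) / (c + 1))) {0..?R}"
    using has_integral_powr_from_0[OF assms, of ?R] by simp
  then have "((\<lambda>x. x powr c / ?R) has_integral (?R powr (c + 1) / (c + 1) / ?R)) {0..?R}"
    by (rule has_integral_divide)
  moreover have "?R powr (c + 1) / (c + 1) / ?R = ?R powr c / (c + 1)"
    by (simp add: powr_add)
  ultimately have "((\<lambda>x. x powr c / ?R) has_integral (?R powr c / (c + 1))) {0..?R}"
    by simp
  then have "(\<integral>\<^sup>+ x. ennreal (x powr c / ?R) * indicator {0..?R} x \<partial>lebesgue)
      = ennreal (?R powr c / (c + 1))"
    unfolding nn_integral_completion by (intro nn_integral_has_integral_lebesgue') auto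
  moreover have "(\<integral>\<^sup>+ x. ennreal ((haar (dyadic_interval (- int k) 0) x)\<^sup>2 * \<bar>x\<bar> powr c) \<partial>lebesgue)
      = (\<integral>\<^sup>+ x. ennreal (x powr c / ?R) * indicator {0..?R} x \<partial>lebesgue)"
  proof (rule nn_integral_cong_AE)
    \<comment> \<open>The dyadic interval is half-open and the interval of integration is closed.\<close>
    have "AE x in lebesgue. x \<noteq> ?R"
      by (rule AE_completion) (rule AE_lborel_singleton)
    then show "AE x in lebesgue. ennreal ((haar (dyadic_interval (- int k) 0) x)\<^sup>2 * \<bar>x\<bar> powr c)
        = ennreal (x powr c / ?R) * indicator {0..?R} x"
      unfolding haar_squared
      by eventually_elim (auto simp: dyadic_interval_def power_int_minus field_simps split: split_indicator)
  qed
  ultimately show ?thesis by simp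
qed

lemma L2W_norm_sq_haar_axis:
  fixes \<alpha> :: real and k :: nat
  defines "J \<equiv> dyadic_interval (- int k) 0"
  shows "- 1 < \<alpha> \<Longrightarrow> L2W_norm_sq (power_weight \<alpha>) (\<lambda>x. haar J x *\<^sub>R axis 1 1)
      = ennreal ((2 ^ k) powr \<alpha> / (1 + \<alpha>))"
    and "\<alpha> < 1 \<Longrightarrow> L2W_norm_sq (power_weight \<alpha>) (\<lambda>x. haar J x *\<^sub>R axis 2 1)
      = ennreal ((2 ^ k) powr (- \<alpha>) / (1 - \<alpha>))"
proof -
  have norm_sq: "(norm (v :: complex ^ 2))\<^sup>2 = (cmod (v $ 1))\<^sup>2 + (cmod (v $ 2))\<^sup>2" for v
    by (simp add: norm_vec_def L2_set_def sum_2)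
  have 1: "(norm (mat_sqrt (power_weight \<alpha> x) *v (haar J x *\<^sub>R axis 1 1)))\<^sup>2
      = (haar J x)\<^sup>2 * \<bar>x\<bar> powr \<alpha>" for x
    unfolding mat_sqrt_power_weight norm_sq using abs_powr_half_squared[of x \<alpha>]
    by (simp add: power_weight_def matrix_vector_mult_def sum_2 axis_def norm_mult power_mult_distrib)
  have 2: "(norm (mat_sqrt (power_weight \<alpha> x) *v (haar J x *\<^sub>R axis 2 1)))\<^sup>2
      = (haar J x)\<^sup>2 * \<bar>x\<bar> powr (- \<alpha>)" for x
    unfolding mat_sqrt_power_weight norm_sq using abs_powr_half_squared[of x "- \<alpha>"]
    by (simp add: power_weight_def matrix_vector_mult_def sum_2 axis_def norm_mult power_mult_distrib)
  show "- 1 < \<alpha> \<Longrightarrow> L2W_norm_sq (power_weight \<alpha>) (\<lambda>x. haar J x *\<^sub>R axis 1 1)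
      = ennreal ((2 ^ k) powr \<alpha> / (1 + \<alpha>))"
    unfolding L2W_norm_sq_def 1 unfolding J_def
    by (simp add: nn_integral_haar_squared_powr add.commute)
  show "\<alpha> < 1 \<Longrightarrow> L2W_norm_sq (power_weight \<alpha>) (\<lambda>x. haar J x *\<^sub>R axis 2 1)
      = ennreal ((2 ^ k) powr (- \<alpha>) / (1 - \<alpha>))"
    unfolding L2W_norm_sq_def 2 unfolding J_def
    by (subst nn_integral_haar_squared_powr) simp_all
qed

lemma haar_scaleR_measurable:
  fixes v :: "complex ^ 2"
  shows "(\<lambda>x. haar (dyadic_interval k m) x *\<^sub>R v) \<in> borel_measurable lebesgue"
  using borel_measurable_integrable[OF haar_integrable[of k m]] by measurable

section \<open>The coordinate swap\<close>

definition swap_matrix :: "complex ^ 2 ^ 2" where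
  "swap_matrix = vector [vector [0, 1], vector [1, 0]]"

lemma swap_matrix_axis: "swap_matrix *v axis 2 1 = axis 1 1"
  by (simp add: swap_matrix_def vec_eq_iff forall_2 matrix_vector_mult_def sum_2 axis_def)

text \<open>The test functions live on large intervals. Intervals shrinking to the origin would serve
  equally well with the two coordinates interchanged, because the weights then trade sizes.\<close>

lemma swap_multiplier_unbounded:
  fixes \<alpha> :: real
  assumes "0 < \<alpha>" and "\<alpha> < 1"
  shows "\<not> haar_multiplier_bounded (power_weight \<alpha>) (\<lambda>I. swap_matrix)"
proof
  assume "haar_multiplier_bounded (power_weight \<alpha>) (\<lambda>I. swap_matrix)"
  then obtain C :: real where C: "\<And>f g. haar_multiplier (power_weight \<alpha>) (\<lambda>I. swap_matrix) f g \<Longrightarrow>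
      L2W_norm_sq (power_weight \<alpha>) g \<le> ennreal (C\<^sup>2) * L2W_norm_sq (power_weight \<alpha>) f"
    unfolding haar_multiplier_bounded_def by blast
  have bound: "(2 powr (2 * \<alpha>)) ^ k \<le> C\<^sup>2 * (1 + \<alpha>) / (1 - \<alpha>)" for k :: nat
  proof -
    define J where "J = dyadic_interval (- int k) 0"
    let ?R = "2 ^ k :: real"
    have J: "J \<in> dyadic_grid" by (auto simp: J_def dyadic_grid_def)
    note norms = L2W_norm_sq_haar_axis[of \<alpha> k, folded J_def]
    have "(\<lambda>x. haar J x *\<^sub>R axis i 1) \<in> L2W (power_weight \<alpha>)" for i :: 2
      using assms norms exhaust_2[of i]
      by (auto simp: L2W_def J_def[symmetric] haar_scaleR_measurable[of "- int k" 0, folded J_def])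
    then have "haar_multiplier (power_weight \<alpha>) (\<lambda>I. swap_matrix)
        (\<lambda>x. haar J x *\<^sub>R axis 2 1) (\<lambda>x. haar J x *\<^sub>R axis 1 1)"
      using haar_multiplier_haar[OF J, of "axis 2 1" "power_weight \<alpha>" "\<lambda>I. swap_matrix"]
      by (simp add: swap_matrix_axis)
    then have "ennreal (?R powr \<alpha> / (1 + \<alpha>)) \<le> ennreal (C\<^sup>2) * ennreal (?R powr (- \<alpha>) / (1 - \<alpha>))"
      using C norms assms by fastforce
    also have "\<dots> = ennreal (C\<^sup>2 * (?R powr (- \<alpha>) / (1 - \<alpha>)))"
      using assms by (intro ennreal_mult[symmetric]) simp_all
    finally have "?R powr \<alpha> / (1 + \<alpha>) \<le> C\<^sup>2 * (?R powr (- \<alpha>) / (1 - \<alpha>))"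
      using assms by (subst (asm) ennreal_le_iff) simp_all
    then have "?R powr \<alpha> * ?R powr \<alpha> \<le> C\<^sup>2 * (1 + \<alpha>) / (1 - \<alpha>)"
      using assms by (simp add: powr_minus field_simps)
    moreover have "?R powr \<alpha> * ?R powr \<alpha> = (2 powr (2 * \<alpha>)) ^ k"
      by (simp add: powr_powr mult_ac flip: powr_add powr_realpow)
    ultimately show ?thesis by simp
  qed
  have "1 < 2 powr (2 * \<alpha>)" using assms by simp
  then obtain k where "C\<^sup>2 * (1 + \<alpha>) / (1 - \<alpha>) < (2 powr (2 * \<alpha>)) ^ k"
    using real_arch_pow by blast
  then show False using bound[of k] by linarith
qed

theorem proposition4p1:
  fixes \<alpha> :: real
  assumes "0 < \<alpha>" and "\<alpha> < 1"
  shows "\<exists>A :: real set \<Rightarrow> complex ^ 2 ^ 2. \<not> haar_multiplier_bounded (power_weight \<alpha>) A"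
  using swap_multiplier_unbounded[OF assms] by blast

end
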